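(* Let $J$ be a multiplicative arithmetical function on the monic polynomials of $A=\mathbb{F}_q[X]$, and let $H(h)=J(h)\mu(h)$ for monic $h$. Let $G$ be a completely multiplicative arithmetical function such that for every monic irreducible $P\in A$ one has $G(P)\neq 0$ and $G(P)\neq J(P)$. For monic $h,f\in A$ put $$S(h;f)=\sum_{g\mid (h,f)} G(g)\,H(f/g),\qquad F(f)=\sum_{g\mid f}G(g)\,H(f/g).$$ Then for all monic $h,f\in A$, $$S(h;f)=\frac{J\left(\frac{f}{(h,f)}\right)\,\mu\left(\frac{f}{(h,f)}\right)\,F(f)}{F\left(\frac{f}{(h,f)}\right)}.$$
   Context: $A=\mathbb{F}_q[X]$ is the polynomial ring over the finite field with $q=p^t$ elements, $p$ prime, $t\ge 1$. An arithmetical function is a complex-valued function on the set of monic polynomials in $A$. An arithmetical function $G$ is multiplicative if $G(1)=1$ and $G(fg)=G(f)G(g)$ for all coprime monic $f,g$; it is completely multiplicative if $G(1)=1$ and $G(fg)=G(f)G(g)$ for all monic $f,g$. The Möbius function $\mu$ is defined by $\mu(f)=0$ if $f$ is not squarefree and $\mu(f)=(-1)^k$ if $f$ is a nonzero constant times a product of $k$ distinct monic irreducibles (so $\mu(1)=1$). $(a,b)$ denotes the monic greatest common divisor, and sums over $g\mid n$ run over the monic divisors $g$ of $n$. *)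

theory Defs
  imports Complex_Main "HOL-Computational_Algebra.Computational_Algebra"
begin

text \<open>
  The coefficient field is a type of sort \<open>{field_gcd, finite}\<close>: on a field, \<open>field_gcd\<close> adds only
  the operations (normalization, gcd, Euclidean structure) that every field carries, and it is
  the class for which the library provides \<open>gcd\<close> on polynomials. An arithmetical function is
  represented by a total function on polynomials of which only the values at monic
  arguments are ever used.
\<close>

definition monic :: "'a::field poly \<Rightarrow> bool" where
  "monic f \<longleftrightarrow> lead_coeff f = 1"

definition multiplicative :: "('a::field poly \<Rightarrow> complex) \<Rightarrow> bool" where
  "multiplicative G \<longleftrightarrow> G 1 = 1 \<and>
     (\<forall>f g. monic f \<longrightarrow> monic g \<longrightarrow> coprime f g \<longrightarrow> G (f * g) = G f * G g)"

definition completely_multiplicative :: "('a::field poly \<Rightarrow> complex) \<Rightarrow> bool" where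
  "completely_multiplicative G \<longleftrightarrow> G 1 = 1 \<and>
     (\<forall>f g. monic f \<longrightarrow> monic g \<longrightarrow> G (f * g) = G f * G g)"

text \<open>The number \<open>k\<close> below exists and is unique for squarefree \<open>f\<close>; see \<open>moebius_smult_prod\<close>
  and \<open>squarefree_decompose\<close>.\<close>

definition moebius :: "'a::field poly \<Rightarrow> complex" where
  "moebius f =
     (if squarefree f
      then (-1) ^ (THE k. \<exists>c S. c \<noteq> 0 \<and> finite S \<and> card S = k \<and>
                     (\<forall>P\<in>S. monic P \<and> irreducible P) \<and> f = smult c (\<Prod>P\<in>S. P))
      else 0)"

lemma unit_factor_field: "c \<noteq> 0 \<Longrightarrow> unit_factor c = c"
  for c :: "'a::field_gcd"
  by (intro is_unit_unit_factor) (simp add: dvd_field_iff)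

lemma monic_iff_normalize:
  fixes p :: "'a::field_gcd poly"
  assumes "p \<noteq> 0"
  shows "monic p \<longleftrightarrow> normalize p = p"
proof -
  have u: "unit_factor (lead_coeff p) = lead_coeff p"
    using assms by (simp add: unit_factor_field)
  show ?thesis
  proof
    assume "monic p"
    then show "normalize p = p"
      by (intro poly_eqI) (simp add: u monic_def)
  next
    assume "normalize p = p"
    then have "lead_coeff p div unit_factor (lead_coeff p) = lead_coeff p"
      by (metis coeff_normalize)
    then show "monic p" using assms by (simp add: u monic_def)
  qed
qed

lemma monic_imp_normalize: "monic p \<Longrightarrow> normalize p = p"
  for p :: "'a::field_gcd poly"
  using monic_iff_normalize[of p] by (cases "p = 0") auto

lemma monic_gcd: "monic f \<Longrightarrow> monic (gcd h f)"
  for f h :: "'a::field_gcd poly"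
  by (subst monic_iff_normalize) (auto simp: monic_def)

lemma finite_monic_divisors:
  fixes f :: "'a::{field_gcd, finite} poly"
  assumes "f \<noteq> 0"
  shows "finite {g. monic g \<and> g dvd f}"
proof (rule finite_subset)
  show "{g. monic g \<and> g dvd f} \<subseteq> Poly ` {xs. set xs \<subseteq> UNIV \<and> length xs \<le> Suc (degree f)}"
  proof
    fix g assume "g \<in> {g. monic g \<and> g dvd f}"
    then have "degree g \<le> degree f" using assms by (auto intro: dvd_imp_degree_le)
    then have "length (coeffs g) \<le> Suc (degree f)"
      by (simp add: coeffs_def)
    then show "g \<in> Poly ` {xs. set xs \<subseteq> UNIV \<and> length xs \<le> Suc (degree f)}"
      by (metis (mono_tags, lifting) Poly_coeffs image_eqI mem_Collect_eq subset_UNIV)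
  qed
  show "finite (Poly ` {xs::'a list. set xs \<subseteq> UNIV \<and> length xs \<le> Suc (degree f)})"
    by (intro finite_imageI finite_lists_length_le) simp
qed

lemma monic_irreducible_dvd_iff:
  fixes S :: "'a::field_gcd poly set"
  assumes "c \<noteq> 0" "finite S" "\<And>P. P \<in> S \<Longrightarrow> monic P \<and> irreducible P"
  shows "S = {P. monic P \<and> irreducible P \<and> P dvd smult c (\<Prod>P\<in>S. P)}"
proof (intro equalityI subsetI CollectI)
  fix P assume "P \<in> S"
  then show "monic P \<and> irreducible P \<and> P dvd smult c (\<Prod>P\<in>S. P)"
    using assms by (auto intro!: dvd_smult dvd_prodI)
next
  fix P assume "P \<in> {P. monic P \<and> irreducible P \<and> P dvd smult c (\<Prod>P\<in>S. P)}"
  then have P: "monic P" "irreducible P" "P dvd (\<Prod>P\<in>S. P)"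
    using assms(1) by (auto simp: dvd_smult_iff)
  from P have "prime_elem P" using irreducible_imp_prime_elem by blast
  with P(3) assms(2) obtain Q where Q: "Q \<in> S" "P dvd Q"
    by (auto simp: prod_unfold_prod_mset elim: prime_elem_dvd_prod_msetE)
  then have "Q dvd P"
    using assms(3) P(2) by (meson irreducibleD' irreducible_not_unit)
  then have "normalize P = normalize Q" using Q by (simp add: associated_iff_dvd)
  then show "P \<in> S" using Q P assms(3) by (simp add: monic_imp_normalize)
qed

lemma moebius_smult_prod:
  fixes S :: "'a::field_gcd poly set"
  assumes c: "c \<noteq> 0" and S: "finite S" "\<And>P. P \<in> S \<Longrightarrow> monic P \<and> irreducible P"
  shows "squarefree (smult c (\<Prod>P\<in>S. P))" "moebius (smult c (\<Prod>P\<in>S. P)) = (-1) ^ card S"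
proof -
  have "squarefree (\<Prod>P\<in>S. P)"
  proof (rule squarefree_prod_coprime)
    fix P Q assume PQ: "P \<in> S" "Q \<in> S" "P \<noteq> Q"
    show "coprime P Q"
    proof (rule ccontr)
      assume "\<not> coprime P Q"
      then have "P dvd Q" "Q dvd P"
        using PQ S(2) by (metis coprime_commute irreducible_imp_prime_elem prime_elem_imp_coprime)+
      then have "normalize P = normalize Q" by (simp add: associated_iff_dvd)
      then show False using PQ S(2) by (simp add: monic_imp_normalize)
    qed
  qed (use S(2) in \<open>auto intro: squarefree_prime_elem irreducible_imp_prime_elem\<close>)
  then show sf: "squarefree (smult c (\<Prod>P\<in>S. P))"
    using c by (simp add: squarefree_def dvd_smult_iff)
  have "(THE k. \<exists>d T. d \<noteq> 0 \<and> finite T \<and> card T = k \<and> (\<forall>P\<in>T. monic P \<and> irreducible P) \<and>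
          smult c (\<Prod>P\<in>S. P) = smult d (\<Prod>P\<in>T. P)) = card S"
  proof (rule the_equality)
    fix k assume "\<exists>d T. d \<noteq> 0 \<and> finite T \<and> card T = k \<and> (\<forall>P\<in>T. monic P \<and> irreducible P) \<and>
          smult c (\<Prod>P\<in>S. P) = smult d (\<Prod>P\<in>T. P)"
    then obtain d T where T: "d \<noteq> 0" "finite T" "card T = k"
      "\<forall>P\<in>T. monic P \<and> irreducible P" "smult c (\<Prod>P\<in>S. P) = smult d (\<Prod>P\<in>T. P)" by blast
    have "T = {P. monic P \<and> irreducible P \<and> P dvd smult d (\<Prod>P\<in>T. P)}"
      by (rule monic_irreducible_dvd_iff) (use T in auto)
    also have "\<dots> = {P. monic P \<and> irreducible P \<and> P dvd smult c (\<Prod>P\<in>S. P)}"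
      using T(5) by simp
    also have "\<dots> = S"
      by (rule monic_irreducible_dvd_iff[symmetric]) (use c S in auto)
    finally show "k = card S" using T by simp
  qed (use c S in blast)
  with sf show "moebius (smult c (\<Prod>P\<in>S. P)) = (-1) ^ card S"
    by (simp add: moebius_def)
qed

lemma squarefree_decompose:
  fixes f :: "'a::field_gcd poly"
  assumes "squarefree f"
  obtains c S where "c \<noteq> 0" "finite S" "\<And>P. P \<in> S \<Longrightarrow> monic P \<and> irreducible P"
    "f = smult c (\<Prod>P\<in>S. P)"
proof -
  have f0: "f \<noteq> 0" using assms by auto
  have eq: "normalize f = (\<Prod>P\<in>prime_factors f. P)"
  proof -
    have "normalize f = (\<Prod>P\<in>prime_factors f. P ^ multiplicity P f)"
      using f0 by (simp add: prod_prime_factors)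
    also have "\<dots> = (\<Prod>P\<in>prime_factors f. P)"
    proof (rule prod.cong)
      fix P assume "P \<in> prime_factors f"
      then show "P ^ multiplicity P f = P"
        using assms f0 by (simp add: squarefree_factorial_semiring')
    qed simp
    finally show ?thesis .
  qed
  show ?thesis
  proof
    show "lead_coeff f \<noteq> 0" using f0 by simp
    show "finite (prime_factors f)" by simp
    show "monic P \<and> irreducible P" if "P \<in> prime_factors f" for P
    proof -
      have P: "prime P" using that by auto
      then have "P \<noteq> 0" "normalize P = P" by (auto simp: prime_def)
      then show ?thesis using P
        by (simp add: monic_iff_normalize prime_elem_imp_irreducible)
    qed
    have "smult (lead_coeff f) (normalize f) = f"
      using f0 by (intro poly_eqI) (simp add: unit_factor_field)
    then show "f = smult (lead_coeff f) (\<Prod>P\<in>prime_factors f. P)" by (simp add: eq)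
  qed
qed

end

theory Submission
  imports Defs
begin

text \<open>
  Write \<open>T d e\<close> for the sum of \<open>G g * H (d * e div g)\<close> over the monic divisors \<open>g\<close> of \<open>d\<close>. Then
  \<open>F n = T n 1\<close>, and \<open>S h f = T d e\<close> for \<open>d = gcd h f\<close> and \<open>e = f div d\<close>. With \<open>k = d div g\<close>
  the summand is \<open>G d * H (k * e) / G k\<close>, because \<open>G\<close> is completely multiplicative and vanishes
  at no monic polynomial. As \<open>H\<close> is supported on squarefree polynomials, only squarefree \<open>k\<close>
  coprime to \<open>e\<close> contribute, and for these \<open>H (k * e) = H k * H e\<close>. Such a \<open>k\<close> is a product of
  distinct primes dividing \<open>d\<close> but not \<open>e\<close>, so the sum over \<open>k\<close> is an expanded Euler product
  (\<open>sum_squarefree_eq_euler_product\<close>), and \<open>T d e = G d * H e * (\<Prod>P. 1 - J P / G P)\<close>, where \<open>P\<close>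
  runs over the primes that divide \<open>d\<close> but not \<open>e\<close> (\<open>sum_divisors_cofactor\<close>).

  Hence \<open>S h f\<close> carries the primes dividing \<open>d\<close> but not \<open>e\<close>, \<open>F e\<close> the primes dividing \<open>e\<close>,
  and \<open>F f\<close> all primes dividing \<open>d * e\<close>, which are these two disjoint sets together; moreover
  \<open>G f = G d * G e\<close>. So \<open>S h f * F e = H e * F f\<close>. Finally \<open>F e\<close> is nonzero because \<open>G e\<close> is
  nonzero and no factor \<open>1 - J P / G P\<close> vanishes.
\<close>

lemma monic_mult_iff:
  assumes "monic f"
  shows "monic (f * g) \<longleftrightarrow> monic g"
  using assms by (simp add: monic_def lead_coeff_mult)

lemma monic_nonzero: "monic f \<Longrightarrow> f \<noteq> 0"
  by (auto simp: monic_def)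

lemma prime_iff_monic_irreducible:
  "prime P \<longleftrightarrow> monic P \<and> irreducible P" for P :: "'a::field_gcd poly"
proof
  assume P: "prime P"
  then have "P \<noteq> 0" "normalize P = P" by (auto simp: prime_def)
  with P show "monic P \<and> irreducible P"
    by (simp add: monic_iff_normalize prime_elem_imp_irreducible)
next
  assume "monic P \<and> irreducible P"
  then show "prime P"
    by (simp add: prime_def monic_imp_normalize irreducible_imp_prime_elem)
qed

lemma monic_prod_primes:
  fixes B :: "'a::field_gcd poly set"
  assumes "\<And>P. P \<in> B \<Longrightarrow> prime P"
  shows "monic (\<Prod>B)"
  using assms
  by (induction B rule: infinite_finite_induct)
    (auto simp: monic_def lead_coeff_mult prime_iff_monic_irreducible)

lemma prime_factors_prod_primes:
  fixes B :: "'a::field_gcd poly set"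
  assumes "finite B" "\<And>P. P \<in> B \<Longrightarrow> prime P"
  shows "prime_factors (\<Prod>B) = B"
proof -
  have "B = {P. monic P \<and> irreducible P \<and> P dvd smult 1 (\<Prod>B)}"
    by (rule monic_irreducible_dvd_iff) (use assms prime_iff_monic_irreducible in auto)
  moreover have "\<Prod>B \<noteq> 0"
    by (intro monic_nonzero monic_prod_primes assms)
  ultimately show ?thesis
    by (auto simp: prime_factors_dvd prime_iff_monic_irreducible)
qed

lemma squarefree_prod_primes:
  fixes B :: "'a::field_gcd poly set"
  assumes "finite B" "\<And>P. P \<in> B \<Longrightarrow> prime P"
  shows "squarefree (\<Prod>B)"
  using moebius_smult_prod(1)[of 1 B] assms by (simp add: prime_iff_monic_irreducible)

lemma prod_prime_factors_squarefree:
  fixes f :: "'a::field_gcd poly"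
  assumes "monic f" "squarefree f"
  shows "\<Prod>(prime_factors f) = f"
proof -
  have "(\<Prod>P\<in>prime_factors f. P) = (\<Prod>P\<in>prime_factors f. P ^ multiplicity P f)"
    using assms monic_nonzero[OF assms(1)]
    by (intro prod.cong) (auto simp: squarefree_factorial_semiring')
  also have "\<dots> = f"
    using assms by (simp add: prod_prime_factors monic_nonzero monic_imp_normalize)
  finally show ?thesis .
qed

lemma multiplicative_prod_primes:
  fixes B :: "'a::field_gcd poly set"
  assumes "multiplicative J" "finite B" "\<And>P. P \<in> B \<Longrightarrow> prime P"
  shows "J (\<Prod>B) = (\<Prod>P\<in>B. J P)"
  using assms(2,3)
proof (induction B)
  case empty
  then show ?case using assms(1) by (simp add: multiplicative_def)
next
  case (insert P B)
  have "coprime P (\<Prod>B)"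
    using insert by (intro prod_coprime_right) (metis insertCI primes_coprime)
  then have "J (P * \<Prod>B) = J P * J (\<Prod>B)"
    using assms(1) insert.prems monic_prod_primes[of B] prime_iff_monic_irreducible[of P]
    by (auto simp: multiplicative_def)
  then show ?case using insert by simp
qed

text \<open>
  The sign of the Moebius function is distributed over the primes, one factor \<open>-1\<close> each, so that
  \<open>J * moebius\<close> can enter an Euler product.
\<close>

lemma multiplicative_moebius_squarefree:
  fixes f :: "'a::field_gcd poly"
  assumes "multiplicative J" "monic f" "squarefree f"
  shows "J f * moebius f = (\<Prod>P\<in>prime_factors f. - J P)"
proof -
  let ?B = "prime_factors f"
  have "J f = (\<Prod>P\<in>?B. J P)"
    using multiplicative_prod_primes[OF assms(1), of ?B]
    by (auto simp: prod_prime_factors_squarefree assms)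
  moreover have "moebius f = (-1) ^ card ?B"
    using moebius_smult_prod(2)[of 1 ?B]
    by (simp add: prod_prime_factors_squarefree assms prime_iff_monic_irreducible[symmetric]
        in_prime_factors_imp_prime)
  ultimately show ?thesis
    by (simp add: prod_uminus)
qed

lemma completely_multiplicative_nonzero:
  fixes G :: "'a::field_gcd poly \<Rightarrow> complex"
  assumes G: "completely_multiplicative G"
    and nz: "\<And>P. prime P \<Longrightarrow> G P \<noteq> 0"
    and "monic f"
  shows "G f \<noteq> 0"
  using monic_nonzero[OF \<open>monic f\<close>] \<open>monic f\<close>
proof (induction f rule: prime_divisors_induct)
  case zero
  then show ?case by simp
next
  case (unit f)
  then have "f = 1" using is_unit_normalize monic_imp_normalize by metis
  then show ?case using G by (simp add: completely_multiplicative_def)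
next
  case (factor P f)
  then have "monic P" by (simp add: prime_iff_monic_irreducible)
  with factor have "monic f" "f \<noteq> 0" by (auto simp: monic_mult_iff)
  with factor \<open>monic P\<close> show ?case
    using G nz by (auto simp: completely_multiplicative_def)
qed

text \<open>
  Expanding the product gives one term for each subset of \<open>A\<close>, and unique factorization
  identifies these subsets with the squarefree monic polynomials composed of primes in \<open>A\<close>.
\<close>

lemma sum_squarefree_eq_euler_product:
  fixes A :: "'a::field_gcd poly set" and u :: "'a poly \<Rightarrow> 'b::comm_ring_1"
  assumes "finite A" "\<And>P. P \<in> A \<Longrightarrow> prime P"
  shows "(\<Sum>k | monic k \<and> squarefree k \<and> prime_factors k \<subseteq> A. \<Prod>P\<in>prime_factors k. u P)
       = (\<Prod>P\<in>A. 1 + u P)"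
proof -
  have "(\<Sum>k | monic k \<and> squarefree k \<and> prime_factors k \<subseteq> A. \<Prod>P\<in>prime_factors k. u P)
      = (\<Sum>B\<in>Pow A. \<Prod>P\<in>B. u P)"
    by (rule sum.reindex_bij_witness[where i = Prod and j = prime_factors])
      (use assms in \<open>auto simp: prod_prime_factors_squarefree subset_iff finite_subset
         prime_factors_prod_primes monic_prod_primes squarefree_prod_primes\<close>)
  also have "\<dots> = (\<Prod>P\<in>A. u P + 1)"
    using assms(1) by (simp add: prod_add)
  finally show ?thesis by (simp add: add.commute)
qed

text \<open>
  For \<open>e = 1\<close> this evaluates \<open>F d\<close>; for \<open>d = gcd h f\<close> and \<open>e = f div d\<close> it evaluates \<open>S h f\<close>.
  Both sides vanish unless \<open>e\<close> is squarefree. For squarefree \<open>e\<close> the terms that survive belong to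
  the squarefree \<open>k = d div g\<close> built from the primes that divide \<open>d\<close> but not \<open>e\<close>.
\<close>

lemma sum_divisors_cofactor:
  fixes J G :: "'a::{field_gcd, finite} poly \<Rightarrow> complex"
  assumes J: "multiplicative J" and G: "completely_multiplicative G"
    and nz: "\<And>P. prime P \<Longrightarrow> G P \<noteq> 0"
    and d: "monic d" and e: "monic e"
  defines "H \<equiv> \<lambda>f. J f * moebius f"
  shows "(\<Sum>g | monic g \<and> g dvd d. G g * H (d * e div g))
       = G d * H e * (\<Prod>P\<in>prime_factors d - prime_factors e. 1 - J P / G P)"
proof -
  let ?A = "prime_factors d - prime_factors e"
  let ?K = "{k. monic k \<and> squarefree k \<and> prime_factors k \<subseteq> ?A}"
  let ?u = "\<lambda>P. - J P / G P"
  have d0: "d \<noteq> 0" and e0: "e \<noteq> 0" using d e by (auto dest: monic_nonzero)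
  have Gnz: "G k \<noteq> 0" if "monic k" for k
    using completely_multiplicative_nonzero[OF G nz that] .
  have G_mult: "multiplicative G"
    using G by (simp add: completely_multiplicative_def multiplicative_def)
  have "(\<Sum>g | monic g \<and> g dvd d. G g * H (d * e div g))
      = (\<Sum>k | monic k \<and> k dvd d. G d / G k * H (k * e))"
  proof (rule sum.reindex_bij_witness[where i = "\<lambda>k. d div k" and j = "\<lambda>g. d div g"])
    fix g assume "g \<in> {g. monic g \<and> g dvd d}"
    then have g: "monic g" "g dvd d" by auto
    then obtain k where k: "d = g * k" by blast
    have g0: "g \<noteq> 0" and k0: "k \<noteq> 0" using d0 k by auto
    have "monic k" using g d k by (simp add: monic_mult_iff)
    then have "G d = G g * G k" using G g k by (simp add: completely_multiplicative_def)
    then show "G d / G (d div g) * H (d div g * e) = G g * H (d * e div g)"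
      using g0 Gnz[OF \<open>monic k\<close>] by (simp add: k mult.assoc)
    show "d div (d div g) = g" using g0 k0 by (simp add: k)
    show "d div g \<in> {k. monic k \<and> k dvd d}" using g0 \<open>monic k\<close> by (simp add: k)
  next
    fix k assume "k \<in> {k. monic k \<and> k dvd d}"
    then have k: "monic k" "k dvd d" by auto
    then obtain g where g: "d = k * g" by blast
    have g0: "g \<noteq> 0" and k0: "k \<noteq> 0" using d0 g by auto
    have "monic g" using k d g by (simp add: monic_mult_iff)
    then show "d div k \<in> {g. monic g \<and> g dvd d}" using k0 by (simp add: g)
    show "d div (d div k) = k" using g0 k0 by (simp add: g)
  qed
  also have "\<dots> = G d * H e * (\<Prod>P\<in>?A. 1 + ?u P)"
  proof (cases "squarefree e")
    case False
    then have "\<not> squarefree (k * e)" for k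
      using squarefree_multD(2) by blast
    with False show ?thesis by (simp add: H_def moebius_def)
  next
    case sf_e: True
    have K_sub: "?K \<subseteq> {k. monic k \<and> k dvd d}"
    proof safe
      fix k assume k: "monic k" "squarefree k" "prime_factors k \<subseteq> ?A"
      have k0: "k \<noteq> 0" using k by (simp add: monic_nonzero)
      show "k dvd d"
      proof (rule multiplicity_le_imp_dvd[OF k0])
        fix P :: "'a poly" assume P: "prime P"
        show "multiplicity P k \<le> multiplicity P d"
        proof (cases "P dvd k")
          case True
          then have "P \<in> prime_factors k" using P k0 by (simp add: prime_factors_dvd)
          then have "multiplicity P k = 1" "P dvd d"
            using k k0 by (auto simp: squarefree_factorial_semiring')
          then show ?thesis using P d0 by (simp add: prime_multiplicity_gt_zero_iff Suc_le_eq)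
        qed (simp add: not_dvd_imp_multiplicity_0)
      qed
    qed
    \<comment> \<open>If \<open>k\<close> is squarefree, it has a prime factor outside \<open>?A\<close>, which then divides \<open>e\<close> as well:
      its square divides \<open>k * e\<close>.\<close>
    have vanish: "H (k * e) = 0" if k: "monic k" "k dvd d" "k \<notin> ?K" for k
    proof -
      have k0: "k \<noteq> 0" using k by (simp add: monic_nonzero)
      have "\<not> squarefree (k * e)"
      proof
        assume sf: "squarefree (k * e)"
        then have "squarefree k" by (rule squarefree_multD)
        then obtain P where P: "P \<in> prime_factors k" "P \<notin> ?A" using k by auto
        then have "P dvd e" using k d0 e0 by (auto simp: prime_factors_dvd k0 dest: dvd_trans)
        with P have "P ^ 2 dvd k * e"
          by (auto simp: power2_eq_square intro: mult_dvd_mono)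
        then have "is_unit P" using sf by (simp add: squarefree_def)
        then show False using P(1) in_prime_factors_imp_prime not_prime_unit by blast
      qed
      then show ?thesis by (simp add: H_def moebius_def)
    qed
    have surviving: "G d / G k * H (k * e) = G d * H e * (\<Prod>P\<in>prime_factors k. ?u P)"
      if "k \<in> ?K" for k
    proof -
      have k: "monic k" "squarefree k" "prime_factors k \<subseteq> ?A" using that by auto
      have k0: "k \<noteq> 0" using k by (simp add: monic_nonzero)
      have disj: "prime_factors k \<inter> prime_factors e = {}" using k(3) by auto
      have "coprime k e"
      proof (rule ccontr)
        assume "\<not> coprime k e"
        then have "\<not> is_unit (gcd k e)" by (simp add: is_unit_gcd_iff coprime_iff_gcd_eq_1)
        then obtain P where "P dvd gcd k e" "prime P"
          using prime_divisor_exists[of "gcd k e"] k0 by auto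
        then show False using disj k0 e0 by (auto simp: prime_factors_dvd)
      qed
      then have "squarefree (k * e)" using k sf_e by (simp add: squarefree_mult_coprime)
      moreover have "monic (k * e)" using k e by (simp add: monic_mult_iff)
      ultimately have "H (k * e) = (\<Prod>P\<in>prime_factors k. - J P) * H e"
        using multiplicative_moebius_squarefree[OF J, of "k * e"]
          multiplicative_moebius_squarefree[OF J e sf_e] disj k0 e0
        by (simp add: H_def prime_factors_product prod.union_disjoint)
      moreover have "G k = (\<Prod>P\<in>prime_factors k. G P)"
        using multiplicative_prod_primes[OF G_mult, of "prime_factors k"] k
        by (auto simp: prod_prime_factors_squarefree)
      moreover have "(\<Prod>P\<in>prime_factors k. ?u P)
          = (\<Prod>P\<in>prime_factors k. - J P) / (\<Prod>P\<in>prime_factors k. G P)"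
        by (rule prod_dividef)
      ultimately show ?thesis by simp
    qed
    have "(\<Sum>k | monic k \<and> k dvd d. G d / G k * H (k * e)) = (\<Sum>k\<in>?K. G d / G k * H (k * e))"
      using K_sub vanish finite_monic_divisors[OF d0]
      by (intro sum.mono_neutral_right) auto
    also have "\<dots> = (\<Sum>k\<in>?K. G d * H e * (\<Prod>P\<in>prime_factors k. ?u P))"
      using surviving by (rule sum.cong[OF refl])
    also have "\<dots> = G d * H e * (\<Prod>P\<in>?A. 1 + ?u P)"
      by (subst sum_squarefree_eq_euler_product[symmetric])
        (auto simp: sum_distrib_left)
    finally show ?thesis .
  qed
  finally show ?thesis by simp
qed

theorem theorem2p2:
  fixes J G H F :: "'a::{field_gcd, finite} poly \<Rightarrow> complex"
    and S :: "'a poly \<Rightarrow> 'a poly \<Rightarrow> complex"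
    and h f :: "'a poly"
  assumes "multiplicative J"
    and "completely_multiplicative G"
    and "\<And>P. monic P \<Longrightarrow> irreducible P \<Longrightarrow> G P \<noteq> 0 \<and> G P \<noteq> J P"
    and "\<And>h. monic h \<Longrightarrow> H h = J h * moebius h"
    and "\<And>h f. monic h \<Longrightarrow> monic f \<Longrightarrow>
           S h f = (\<Sum>g | monic g \<and> g dvd gcd h f. G g * H (f div g))"
    and "\<And>f. monic f \<Longrightarrow> F f = (\<Sum>g | monic g \<and> g dvd f. G g * H (f div g))"
    and "monic h" and "monic f"
  shows "S h f = J (f div gcd h f) * moebius (f div gcd h f) * F f / F (f div gcd h f)"
proof -
  define d where "d = gcd h f"
  define e where "e = f div d"
  let ?w = "\<lambda>P. 1 - J P / G P"
  have f: "f = d * e" by (simp add: d_def e_def)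
  have d: "monic d" unfolding d_def using \<open>monic f\<close> by (rule monic_gcd)
  with f \<open>monic f\<close> have e: "monic e" by (simp add: monic_mult_iff)
  have G_nz: "G P \<noteq> 0" "?w P \<noteq> 0" if "prime P" for P
    using assms(3)[of P] that by (auto simp: prime_iff_monic_irreducible)
  have H_cofactor: "H (n div g) = J (n div g) * moebius (n div g)"
    if "monic n" "g dvd n" "monic g" for n g
    using that assms(4) monic_mult_iff[of g "n div g"] by simp
  note sum_cofactor = sum_divisors_cofactor[OF assms(1,2) G_nz(1)]
  have F: "F n = G n * (\<Prod>P\<in>prime_factors n. ?w P)" if n: "monic n" for n
  proof -
    have "J 1 * moebius (1 :: 'a poly) = 1"
      using multiplicative_moebius_squarefree[OF assms(1), of 1] by (simp add: monic_def)
    moreover have "F n = (\<Sum>g | monic g \<and> g dvd n. G g * (J (n * 1 div g) * moebius (n * 1 div g)))"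
      unfolding assms(6)[OF n] using n by (intro sum.cong) (auto simp: H_cofactor)
    ultimately show ?thesis
      using sum_cofactor[OF _ n, of 1] by (simp add: monic_def)
  qed
  have "S h f = (\<Sum>g | monic g \<and> g dvd d. G g * (J (d * e div g) * moebius (d * e div g)))"
    unfolding assms(5)[OF \<open>monic h\<close> \<open>monic f\<close>] d_def[symmetric]
    using \<open>monic f\<close> by (intro sum.cong) (auto simp: f H_cofactor)
  also have "\<dots> = G d * (J e * moebius e) * (\<Prod>P\<in>prime_factors d - prime_factors e. ?w P)"
    by (intro sum_cofactor d e)
  finally have S: "S h f = \<dots>" .
  have "prime_factors f = (prime_factors d - prime_factors e) \<union> prime_factors e"
    using d e by (auto simp: f prime_factors_product monic_nonzero)
  then have "(\<Prod>P\<in>prime_factors f. ?w P)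
      = (\<Prod>P\<in>prime_factors d - prime_factors e. ?w P) * (\<Prod>P\<in>prime_factors e. ?w P)"
    by (simp only:, intro prod.union_disjoint) auto
  moreover have "G f = G d * G e"
    using assms(2) d e by (simp add: f completely_multiplicative_def)
  ultimately have "S h f * F e = J e * moebius e * F f"
    by (simp add: S F e \<open>monic f\<close>)
  moreover have "G e \<noteq> 0"
    using completely_multiplicative_nonzero[OF assms(2) G_nz(1) e] .
  then have "F e \<noteq> 0"
    using G_nz(2) by (auto simp: F e in_prime_factors_imp_prime)
  ultimately show ?thesis
    by (simp add: d_def[symmetric] e_def[symmetric] eq_divide_eq)
qed

end
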